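(* Let $G$ be a unicyclic graph with girth $g$, let $R=\{v\in V(G):\deg(v)\le 2\}$ and $r=|R|$. Then $Z_{(2)}(G)$ is given by the first of the following cases that applies (degrees are degrees in $G$). (i) $Z_{(2)}(G)=r+2$ if $g\in\{3,4\}$ and every cycle vertex has degree $3$. (ii) $Z_{(2)}(G)=r+1$ if $g=3$ and two cycle vertices have degree $3$; or if $g=4$ and either $G$ contains two non-adjacent cycle vertices with degree $3$, or $G$ contains three cycle vertices of degree $3$. (iii) $Z_{(2)}(G)=r$ otherwise (including whenever $g\ge 5$).
   Context: All graphs are finite, simple and undirected. Let $G$ be a graph, $S\subseteq V(G)$ a set of initially blue vertices (all other vertices white), and $L\subseteq V(G)$ a set of leaks. The leaky color change rule: a blue vertex $b\notin L$ which has exactly one white neighbor $w$ may force $w$ to become blue. $S$ is an $\ell$-leaky forcing set if for every choice of a set $L$ of $\ell$ leaks, repeated application of the rule eventually turns all vertices blue. $Z_{(\ell)}(G)$ is the minimum size of an $\ell$-leaky forcing set of $G$. A unicyclic graph is a connected graph containing exactly one cycle; its girth is the length of that cycle. The vertices of the cycle are called cycle vertices. *)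

theory Defs
  imports "Graph_Theory.Graph_Theory"
begin

text \<open>
  A finite simple undirected graph is a \<open>pair_graph\<close>: every edge is represented by its two
  opposite arcs, so that \<open>out_degree\<close> is the degree. Note that \<open>pre_digraph.cycle\<close> also holds of
  the closed walk that traverses a single edge back and forth, hence the lower bound on the length.
\<close>

definition graph_cycle :: "'a pair_pre_digraph \<Rightarrow> ('a \<times> 'a) awalk \<Rightarrow> bool" where
  "graph_cycle G p \<longleftrightarrow> pre_digraph.cycle (with_proj G) p \<and> 3 \<le> length p"

definition undirected_edges :: "('a \<times> 'a) awalk \<Rightarrow> 'a set set" where
  "undirected_edges p = (\<lambda>(u, v). {u, v}) ` set p"

text \<open>
  One cycle has many traversals (choice of starting vertex and direction); two traversals describe
  the same cycle iff they have the same undirected edges.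
\<close>

definition unicyclic :: "'a pair_pre_digraph \<Rightarrow> bool" where
  "unicyclic G \<longleftrightarrow> pair_graph G \<and> connected (with_proj G) \<and>
     (\<exists>!E. \<exists>p. graph_cycle G p \<and> E = undirected_edges p)"

definition cycle_verts :: "('a \<times> 'a) awalk \<Rightarrow> 'a set" where
  "cycle_verts p = \<Union> (undirected_edges p)"

text \<open>\<open>leaky_force G L B B'\<close>: one application of the rule turns the blue set \<open>B\<close> into \<open>B'\<close>.\<close>

definition leaky_force :: "'a pair_pre_digraph \<Rightarrow> 'a set \<Rightarrow> 'a set \<Rightarrow> 'a set \<Rightarrow> bool" where
  "leaky_force G L B B' \<longleftrightarrow>
     (\<exists>b w. b \<in> B \<and> b \<notin> L \<and> {x \<in> pverts G. (b, x) \<in> parcs G \<and> x \<notin> B} = {w} \<and> B' = insert w B)"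

definition leaky_forcing_set :: "nat \<Rightarrow> 'a pair_pre_digraph \<Rightarrow> 'a set \<Rightarrow> bool" where
  "leaky_forcing_set l G S \<longleftrightarrow> S \<subseteq> pverts G \<and>
     (\<forall>L. L \<subseteq> pverts G \<and> card L = l \<longrightarrow> (leaky_force G L)\<^sup>*\<^sup>* S (pverts G))"

definition leaky_forcing_number :: "nat \<Rightarrow> 'a pair_pre_digraph \<Rightarrow> nat" where
  "leaky_forcing_number l G = (LEAST k. \<exists>S. leaky_forcing_set l G S \<and> card S = k)"

end

theory Submission
  imports Defs
begin

text \<open>
  For a set \<open>F\<close> of vertices call a vertex outside \<open>F\<close> with exactly one neighbour in \<open>F\<close> a single
  contact of \<open>F\<close>. Only a single contact can ever force into a completely white \<open>F\<close>. Hence leaks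
  placed on all single contacts keep \<open>F\<close> white for ever, and conversely a stalled process leaves a
  white set all of whose single contacts are leaks. So \<open>S\<close> is a 2-leaky forcing set iff it meets
  every nonempty \<open>F\<close> with at most two single contacts (\<open>leaky_forcing_set_iff_fort\<close>); such an \<open>F\<close>
  is called a fort below.

  A vertex of degree at most 2 is a fort by itself, so it lies in every 2-leaky forcing set. It
  remains to find the forts whose vertices all have degree at least 3. Let \<open>N\<close> be the set of
  outside neighbours of such a fort \<open>F\<close> and consider the edges with an end in \<open>F\<close>. They form a
  graph on \<open>F \<union> N\<close> with at most one cycle, so there are at most \<open>card F + card N\<close> of them. Counted as
  arcs, those that leave \<open>F\<close> number the sum of the degrees, and those that leave \<open>N\<close> number at
  least 2 for each vertex of \<open>N\<close> that is not a single contact, and 1 for each that is. The terms in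
  \<open>card N\<close> cancel and leave (\<open>fort_degree_sum_le\<close>)
  \<open>(\<Sum>v\<in>F. deg v) \<le> 2 * card F + card (single contacts of F)\<close>.
  With all degrees at least 3 this gives \<open>card F \<le> 2\<close>. One vertex of degree at least 3 is not a fort,
  so \<open>F = {u, v}\<close>, both degrees are 3 and there are exactly two single contacts. This means that
  \<open>u\<close> and \<open>v\<close> are adjacent with a common neighbour, or non-adjacent with two common neighbours: two
  vertices of a triangle, or opposite vertices of a 4-cycle, and in either case of the unique cycle
  (\<open>two_fort_is_obstructing_pair\<close>).

  Therefore \<open>leaky_forcing_number 2 G\<close> exceeds \<open>r\<close> by the least number of vertices that meet all these pairs. In a
  triangle the pairs are all pairs of degree-3 cycle vertices, in a 4-cycle they are at most the two
  diagonals, and for longer cycles there are none; this yields the three cases.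
\<close>

section \<open>Counting arcs in graphs with few cycles\<close>

text \<open>
  A cycle given by its vertices, the first one \<open>u\<close> kept apart because the closing arc returns to
  it. Stating it for an arbitrary relation lets cycles of subgraphs be cycles of the whole graph by
  monotonicity.
\<close>

definition closed_path :: "'a rel \<Rightarrow> 'a \<Rightarrow> 'a list \<Rightarrow> bool" where
  "closed_path A u ys \<longleftrightarrow> distinct (u # ys) \<and> 2 \<le> length ys \<and>
     successively (\<lambda>a b. (a, b) \<in> A) (u # ys @ [u])"

lemma closed_path_mono: "closed_path A u ys \<Longrightarrow> A \<subseteq> B \<Longrightarrow> closed_path B u ys"
  unfolding closed_path_def by (auto elim: successively_mono)

text \<open>
  The first vertex of a longest path has all its neighbours on the path. One of its two neighbours
  is not the second vertex, and the arc back from that one closes a cycle.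
\<close>

lemma closed_path_if_min_degree_two:
  assumes fin: "finite X" and ne: "X \<noteq> {}" and AX: "A \<subseteq> X \<times> X"
    and sym: "sym A" and irr: "irrefl A"
    and two: "\<And>x. x \<in> X \<Longrightarrow> \<exists>y z. y \<noteq> z \<and> (x, y) \<in> A \<and> (x, z) \<in> A"
  shows "\<exists>u ys. closed_path A u ys"
proof -
  define P where "P xs \<longleftrightarrow> xs \<noteq> [] \<and> distinct xs \<and> set xs \<subseteq> X \<and> successively (\<lambda>a b. (a, b) \<in> A) xs"
    for xs
  obtain x0 where "x0 \<in> X" using ne by auto
  then have P0: "P [x0]" by (simp add: P_def)
  have bound: "length xs < Suc (card X)" if "P xs" for xs
    using that fin by (metis P_def card_mono distinct_card le_imp_less_Suc)
  obtain xs where Pxs: "P xs" and longest: "\<And>zs. P zs \<Longrightarrow> length zs \<le> length xs"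
    using ex_has_greatest_nat[of P "[x0]" length "Suc (card X)"] P0 bound by blast
  then obtain x xs' where xs: "xs = x # xs'" by (cases xs) (auto simp: P_def)
  have x: "x \<in> X" using Pxs xs by (auto simp: P_def)
  have nbr: "y \<in> set xs'" if "(x, y) \<in> A" for y
  proof (rule ccontr)
    assume "y \<notin> set xs'"
    moreover have "y \<noteq> x" using that irr by (auto simp: irrefl_def)
    moreover have "y \<in> X" using that AX by auto
    moreover have "(y, x) \<in> A" using that sym by (auto dest: symD)
    ultimately have "P (y # xs)" using Pxs by (auto simp: P_def xs)
    from longest[OF this] show False by simp
  qed
  obtain y where y: "(x, y) \<in> A" "y \<in> set xs'" "y \<noteq> hd xs'"
    using two[OF x] nbr by metis
  obtain h t where t: "xs' = h # t" using y by (cases xs') auto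
  with y have "y \<in> set t" by auto
  then obtain t1 t2 where "t = t1 @ y # t2" by (auto dest: split_list)
  with t xs have xs2: "xs = (x # h # t1 @ [y]) @ t2" by simp
  have "successively (\<lambda>a b. (a, b) \<in> A) (x # h # t1 @ [y])"
    using Pxs unfolding P_def xs2 successively_append_iff by blast
  moreover have "(y, x) \<in> A" using y sym by (auto dest: symD)
  ultimately have "successively (\<lambda>a b. (a, b) \<in> A) ((x # h # t1 @ [y]) @ [x])"
    unfolding successively_append_iff by simp
  then have "closed_path A x (h # t1 @ [y])"
    using Pxs unfolding closed_path_def P_def xs2 by auto
  then show ?thesis by blast
qed

text \<open>
  A graph without cycles has a vertex with at most one neighbour; removing it costs one edge, that
  is, two arcs. The bound is the edge count of a forest doubled, since every edge is two arcs.
\<close>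

lemma card_arcs_forest:
  assumes "finite X" "X \<noteq> {}" "A \<subseteq> X \<times> X" "sym A" "irrefl A"
    and "\<And>u ys. \<not> closed_path A u ys"
  shows "card A + 2 \<le> 2 * card X"
  using assms
proof (induction "card X" arbitrary: X A rule: less_induct)
  case less
  note fin = less.prems(1) and AX = less.prems(3)
  have finA: "finite A" using AX fin by (meson finite_SigmaI finite_subset)
  obtain x where x: "x \<in> X" "\<And>y z. (x, y) \<in> A \<Longrightarrow> (x, z) \<in> A \<Longrightarrow> y = z"
    using closed_path_if_min_degree_two[OF less.prems(1-5)] less.prems(6) by meson
  define A' where "A' = A \<inter> (X - {x}) \<times> (X - {x})"
  show ?case
  proof (cases "X = {x}")
    case True
    then have "A = {}" using AX less.prems(5) by (auto simp: irrefl_def)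
    then show ?thesis using True by simp
  next
    case False
    have "card A' + 2 \<le> 2 * card (X - {x})"
    proof (rule less.hyps)
      show "card (X - {x}) < card X" using fin x(1) by (rule card_Diff1_less)
      show "sym A'" using less.prems(4) unfolding A'_def sym_def by blast
      show "irrefl A'" using less.prems(5) by (simp add: A'_def irrefl_def)
      show "\<not> closed_path A' u ys" for u ys
        using less.prems(6) closed_path_mono[of A' u ys A] by (simp add: A'_def) blast
    qed (use False x(1) fin in \<open>auto simp: A'_def\<close>)
    moreover have "card A \<le> card A' + 2"
    proof -
      \<comment> \<open>If \<open>x\<close> has no neighbour, any \<open>y\<close> will do.\<close>
      obtain y where y: "\<And>z. (x, z) \<in> A \<Longrightarrow> z = y" using x(2) by blast
      have "A \<subseteq> A' \<union> {(x, y), (y, x)}"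
      proof (rule subrelI)
        fix a b assume ab: "(a, b) \<in> A"
        then have "(b, a) \<in> A" using less.prems(4) by (simp add: symD)
        then show "(a, b) \<in> A' \<union> {(x, y), (y, x)}" using ab y AX by (auto simp: A'_def)
      qed
      then have "card A \<le> card (A' \<union> {(x, y), (y, x)})"
        using finA by (intro card_mono) (simp_all add: A'_def)
      moreover have "card (A' \<union> {(x, y), (y, x)}) \<le> card A' + card {(x, y), (y, x)}"
        by (rule card_Un_le)
      moreover have "card {(x, y), (y, x)} \<le> 2" using card_length[of "[(x, y), (y, x)]"] by simp
      ultimately show ?thesis by linarith
    qed
    moreover have "card X = Suc (card (X - {x}))" using card.remove[OF fin x(1)] .
    ultimately show ?thesis by simp
  qed
qed

section \<open>Arc walks and vertex cycles\<close>

text \<open>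
  The heads of the arcs list the vertices that follow the starting vertex, so requiring them to be
  distinct is the library's distinctness condition.
\<close>

lemma graph_cycle_iff:
  "graph_cycle G p \<longleftrightarrow> (\<exists>u. u \<in> pverts G \<and> set p \<subseteq> parcs G \<and> pcas u p u \<and>
     distinct (map snd p) \<and> 3 \<le> length p)"
proof -
  have "tl (pawalk_verts u p) = map snd p" if "pcas u p u" "p \<noteq> []" for u
    using that pre_digraph.awalk_verts_conv'[of "with_proj G" u p u]
    by (simp add: cas_with_proj_eq awalk_verts_with_proj_eq)
  then show ?thesis
    unfolding graph_cycle_def pre_digraph.cycle_def pre_digraph.awalk_def
    by (force simp: cas_with_proj_eq awalk_verts_with_proj_eq)
qed

lemma cycle_verts_eq: 
  assumes "graph_cycle G p"
  shows "cycle_verts p = set (map snd p)"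
proof -
  obtain u where u: "pcas u p u" "p \<noteq> []" using assms by (force simp: graph_cycle_iff)
  have ends: "insert v (fst ` set p) = insert u (snd ` set p)" if "pcas u p v" for u v
    using that by (induction p arbitrary: u) auto
  have "u \<in> fst ` set p" using u by (cases p) auto
  then have "fst ` set p \<subseteq> snd ` set p \<union> {u}" "u \<in> fst ` set p" using ends[OF u(1)] by auto
  moreover have "v \<in> snd ` set p" if "pcas u p v" "p \<noteq> []" for u v
    using that by (induction p arbitrary: u) (auto, metis list.set_intros(1) pcas.simps(1))
  ultimately have "fst ` set p \<subseteq> snd ` set p" using u by auto
  then show ?thesis by (force simp: cycle_verts_def undirected_edges_def)
qed

lemma card_cycle_verts: "graph_cycle G p \<Longrightarrow> card (cycle_verts p) = length p"
  by (simp add: cycle_verts_eq) (metis distinct_card graph_cycle_iff length_map set_map)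

lemma pcas_zip: "pcas u (zip (u # ys) (ys @ [v])) v"
  by (induction ys arbitrary: u) auto

lemma set_zip_subset_iff_successively:
  "set (zip (u # ys) (ys @ [v])) \<subseteq> A \<longleftrightarrow> successively (\<lambda>a b. (a, b) \<in> A) (u # ys @ [v])"
  by (induction ys arbitrary: u) auto

text \<open>
  Returns from vertices to arc walks, in which form uniqueness of the cycle is assumed.
\<close>

lemma graph_cycle_zip:
  assumes "pair_graph G" "closed_path A u ys" "A \<subseteq> parcs G"
  defines "q \<equiv> zip (u # ys) (ys @ [u])"
  shows "graph_cycle G q" "set q \<subseteq> A" "cycle_verts q = insert u (set ys)"
proof -
  interpret pair_graph G by fact
  show A: "set q \<subseteq> A"
    using assms(2) by (simp add: q_def set_zip_subset_iff_successively closed_path_def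
        del: zip.simps)
  have snd: "map snd q = ys @ [u]" by (simp add: q_def del: zip.simps)
  have "u \<in> pverts G"
  proof -
    have "u \<in> set (map snd q)" unfolding snd by simp
    then show ?thesis using A assms(3) by (fastforce dest: arc_snd_in_verts)
  qed
  moreover have "pcas u q u" unfolding q_def by (rule pcas_zip)
  ultimately show "graph_cycle G q"
    unfolding graph_cycle_iff using A assms(2,3) 
    by (intro exI[of _ u]) (auto simp: snd closed_path_def q_def simp del: zip.simps)
  then show "cycle_verts q = insert u (set ys)" by (simp add: cycle_verts_eq snd flip: set_map)
qed


lemma cycle_verts_unique:
  assumes "unicyclic G" "graph_cycle G p" "graph_cycle G q"
  shows "cycle_verts p = cycle_verts q"
  using assms unfolding unicyclic_def cycle_verts_def by metis

text \<open>
  Deleting one edge of the unique cycle from the graph leaves no cycle at all, so the forest bound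
  applies to what remains and the deleted edge adds two arcs.
\<close>

lemma unicyclic_card_arcs_le:
  assumes uni: "unicyclic G" and AG: "A \<subseteq> parcs G" and sym: "sym A"
    and fin: "finite X" and AX: "A \<subseteq> X \<times> X"
  shows "card A \<le> 2 * card X"
proof (cases "X = {}")
  case False
  interpret pair_graph G using uni by (simp add: unicyclic_def)
  obtain p where p: "graph_cycle G p" using uni by (auto simp: unicyclic_def)
  then obtain a b where ab: "(a, b) \<in> set p" by (cases p) (force simp: graph_cycle_iff)+
  define A' where "A' = A - {(a, b), (b, a)}"
  have "card A' + 2 \<le> 2 * card X"
  proof (rule card_arcs_forest)
    show "sym A'" using sym by (auto simp: A'_def sym_def)
    show "irrefl A'" using AG no_loops by (fastforce simp: A'_def irrefl_def)
    show "\<not> closed_path A' u ys" for u ys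
    proof
      assume cp: "closed_path A' u ys"
      have "A' \<subseteq> parcs G" using AG by (auto simp: A'_def)
      from graph_cycle_zip[OF pair_graph cp this]
      obtain q where q: "graph_cycle G q" "set q \<subseteq> A'" by blast
      have "undirected_edges q = undirected_edges p"
        using uni p q unfolding unicyclic_def by metis
      moreover have "{a, b} \<in> undirected_edges p" using ab by (force simp: undirected_edges_def)
      ultimately have "{a, b} \<in> undirected_edges q" by simp
      then obtain c d where "(c, d) \<in> set q" "{a, b} = {c, d}"
        unfolding undirected_edges_def by auto
      then show False using q(2) by (auto simp: A'_def doubleton_eq_iff)
    qed
  qed (use False fin AX in \<open>auto simp: A'_def\<close>)
  moreover have "card A \<le> card A' + 2"
  proof -
    have "finite A" using AX fin by (meson finite_SigmaI finite_subset)
    then have "card A \<le> card (A' \<union> {(a, b), (b, a)})" by (intro card_mono) (auto simp: A'_def)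
    also have "\<dots> \<le> card A' + card {(a, b), (b, a)}" by (rule card_Un_le)
    also have "\<dots> \<le> card A' + 2" using card_length[of "[(a, b), (b, a)]"] by simp
    finally show ?thesis .
  qed
  ultimately show ?thesis by simp
qed (use AX in auto)

section \<open>Leaky forcing and forts\<close>

definition nbr :: "'a pair_pre_digraph \<Rightarrow> 'a \<Rightarrow> 'a set" where
  "nbr G v = {w. (v, w) \<in> parcs G}"

definition single_contacts :: "'a pair_pre_digraph \<Rightarrow> 'a set \<Rightarrow> 'a set" where
  "single_contacts G F = {v \<in> pverts G - F. card (nbr G v \<inter> F) = 1}"

lemma out_degree_eq_card_nbr: "out_degree (with_proj G) v = card (nbr G v)"
proof -
  have "out_arcs (with_proj G) v = Pair v ` nbr G v" by (auto simp: out_arcs_def nbr_def)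
  then show ?thesis by (simp add: out_degree_def card_image inj_on_def)
qed

context pair_graph
begin

lemma nbr_subset: "nbr G v \<subseteq> pverts G"
  by (auto simp: nbr_def dest: in_arcsD2)

lemma finite_nbr [simp]: "finite (nbr G v)"
  using nbr_subset pair_finite_verts finite_subset by blast

lemma nbr_sym: "w \<in> nbr G v \<longleftrightarrow> v \<in> nbr G w"
  using arcs_symmetric by (auto simp: nbr_def)

lemma not_in_nbr_self [simp]: "v \<notin> nbr G v"
  using no_loops by (fastforce simp: nbr_def)

lemma finite_single_contacts [simp]: "finite (single_contacts G F)"
  by (simp add: single_contacts_def pair_finite_verts)

lemma single_contacts_singleton: "single_contacts G {v} = nbr G v"
proof -
  have "card (nbr G x \<inter> {v}) = 1 \<longleftrightarrow> v \<in> nbr G x" for x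
    by (cases "v \<in> nbr G x") auto
  then show ?thesis
    using nbr_subset nbr_sym by (auto simp: single_contacts_def)
qed

lemma single_contacts_doubleton:
  assumes "u \<noteq> v"
  shows "single_contacts G {u, v} = (nbr G u - {v} - nbr G v) \<union> (nbr G v - {u} - nbr G u)"
proof -
  have "card (nbr G x \<inter> {u, v}) = 1 \<longleftrightarrow> (u \<in> nbr G x \<longleftrightarrow> v \<notin> nbr G x)" for x
    using assms by (cases "u \<in> nbr G x"; cases "v \<in> nbr G x") auto
  then show ?thesis
    using nbr_subset nbr_sym by (auto simp: single_contacts_def)
qed

text \<open>
  A vertex that forces into the white set \<open>F\<close> for the first time has its only white neighbour
  there, hence is a single contact of \<open>F\<close>, and these are all leaks.
\<close>

lemma fort_blocks_leaky_force:
  assumes "(leaky_force G L)\<^sup>*\<^sup>* B B'" and "F \<inter> B = {}" and "F \<subseteq> pverts G"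
    and "B \<subseteq> pverts G" and "single_contacts G F \<subseteq> L"
  shows "F \<inter> B' = {}"
proof -
  from assms(1) have "F \<inter> B' = {} \<and> B' \<subseteq> pverts G"
  proof (induction rule: rtranclp_induct)
    case base
    then show ?case using assms by simp
  next
    case (step B1 B2)
    then obtain b w where b: "b \<in> B1" "b \<notin> L" "B2 = insert w B1"
      and w: "{x \<in> pverts G. (b, x) \<in> parcs G \<and> x \<notin> B1} = {w}"
      unfolding leaky_force_def by blast
    have "w \<notin> F"
    proof
      assume "w \<in> F"
      then have "nbr G b \<inter> F = {w}" using w step.IH assms(3) by (auto simp: nbr_def)
      then have "b \<in> single_contacts G F" using b step.IH by (auto simp: single_contacts_def)
      then show False using b assms(5) by auto
    qed
    then show ?case using b w step.IH by auto
  qed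
  then show ?thesis ..
qed

text \<open>
  The complement of a largest reachable blue set: a single contact of it outside \<open>L\<close> could still
  force.
\<close>

lemma fort_if_leaky_force_stuck:
  assumes "S \<subseteq> pverts G" and "\<not> (leaky_force G L)\<^sup>*\<^sup>* S (pverts G)"
  obtains F where "F \<subseteq> pverts G" "F \<noteq> {}" "F \<inter> S = {}" "single_contacts G F \<subseteq> L"
proof -
  define P where "P B \<longleftrightarrow> (leaky_force G L)\<^sup>*\<^sup>* S B \<and> S \<subseteq> B \<and> B \<subseteq> pverts G" for B
  have "P S" using assms by (simp add: P_def)
  moreover have "card B < Suc (card (pverts G))" if "P B" for B
    using that pair_finite_verts by (auto simp: P_def less_Suc_eq_le intro: card_mono)
  ultimately obtain B where B: "P B" and max: "\<And>B'. P B' \<Longrightarrow> card B' \<le> card B"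
    using ex_has_greatest_nat[of P S card "Suc (card (pverts G))"] by blast
  have "b \<in> L" if b: "b \<in> single_contacts G (pverts G - B)" for b
  proof (rule ccontr)
    assume "b \<notin> L"
    from b obtain w where w: "nbr G b \<inter> (pverts G - B) = {w}" and "b \<in> B"
      by (auto simp: single_contacts_def card_1_singleton_iff)
    have "{x \<in> pverts G. (b, x) \<in> parcs G \<and> x \<notin> B} = nbr G b \<inter> (pverts G - B)"
      by (auto simp: nbr_def)
    then have "leaky_force G L B (insert w B)"
      using w \<open>b \<in> B\<close> \<open>b \<notin> L\<close> unfolding leaky_force_def by blast
    then have "P (insert w B)" using B w by (auto simp: P_def intro: rtranclp.rtrancl_into_rtrancl)
    moreover have "finite B" using B pair_finite_verts by (auto simp: P_def intro: finite_subset)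
    moreover have "w \<notin> B" using w by auto
    ultimately show False using max[of "insert w B"] by simp
  qed
  moreover have "pverts G - B \<noteq> {}" using B assms(2) by (auto simp: P_def)
  ultimately show thesis using that[of "pverts G - B"] B by (auto simp: P_def)
qed

lemma leaky_forcing_set_iff_fort:
  assumes "l \<le> card (pverts G)"
  shows "leaky_forcing_set l G S \<longleftrightarrow> S \<subseteq> pverts G \<and>
    (\<forall>F \<subseteq> pverts G. F \<noteq> {} \<and> card (single_contacts G F) \<le> l \<longrightarrow> F \<inter> S \<noteq> {})"
    (is "?l \<longleftrightarrow> _ \<and> ?r")
proof (intro iffI conjI)
  assume l: ?l
  then show S: "S \<subseteq> pverts G" by (simp add: leaky_forcing_set_def)
  show ?r
  proof (intro allI impI notI)
    fix F assume F: "F \<subseteq> pverts G" "F \<noteq> {} \<and> card (single_contacts G F) \<le> l" "F \<inter> S = {}"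
    have "single_contacts G F \<subseteq> pverts G" by (auto simp: single_contacts_def)
    \<comment> \<open>The rule asks for exactly \<open>l\<close> leaks, so the single contacts are padded by other vertices.\<close>
    then obtain L where L: "single_contacts G F \<subseteq> L" "L \<subseteq> pverts G" "card L = l"
      using exists_subset_between[of "single_contacts G F" l "pverts G"] F assms pair_finite_verts
      by metis
    then have "(leaky_force G L)\<^sup>*\<^sup>* S (pverts G)" using l by (simp add: leaky_forcing_set_def)
    from fort_blocks_leaky_force[OF this F(3,1) S L(1)] F show False by auto
  qed
next
  assume r: "S \<subseteq> pverts G \<and> ?r"
  show ?l
    unfolding leaky_forcing_set_def
  proof (intro conjI allI impI)
    fix L assume L: "L \<subseteq> pverts G \<and> card L = l"
    show "(leaky_force G L)\<^sup>*\<^sup>* S (pverts G)"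
    proof (rule ccontr)
      assume "\<not> ?thesis"
      then obtain F where F: "F \<subseteq> pverts G" "F \<noteq> {}" "F \<inter> S = {}" "single_contacts G F \<subseteq> L"
        using fort_if_leaky_force_stuck r by metis
      then have "card (single_contacts G F) \<le> l"
        using L by (metis card_mono finite_subset pair_finite_verts)
      then show False using r F by blast
    qed
  qed (use r in simp)
qed

end

section \<open>Small forts in a unicyclic graph\<close>

text \<open>
  Double counting of the arcs with an end in \<open>F\<close>: \<open>N\<close> is the set of outside neighbours of \<open>F\<close>, and
  \<open>card N\<close> cancels because each of its vertices contributes two arcs into \<open>F\<close> unless it is a single
  contact.
\<close>

lemma fort_degree_sum_le:
  assumes uni: "unicyclic G" and F: "F \<subseteq> pverts G"
  shows "(\<Sum>v\<in>F. card (nbr G v)) \<le> 2 * card F + card (single_contacts G F)"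
proof -
  interpret pair_graph G using uni by (simp add: unicyclic_def)
  have finF: "finite F" using F pair_finite_verts finite_subset by blast
  define N where "N = (\<Union>v\<in>F. nbr G v) - F"
  have finN: "finite N" using finF by (simp add: N_def)
  have FN: "F \<inter> N = {}" by (auto simp: N_def)
  define A where "A = Sigma F (nbr G) \<union> Sigma N (\<lambda>v. nbr G v \<inter> F)"
  have "card A \<le> 2 * card (F \<union> N)"
  proof (rule unicyclic_card_arcs_le[OF uni])
    show "A \<subseteq> parcs G" by (auto simp: A_def nbr_def)
    show "sym A" using nbr_sym by (auto simp: A_def N_def sym_def)
    show "A \<subseteq> (F \<union> N) \<times> (F \<union> N)" by (auto simp: A_def N_def)
  qed (use finF finN in simp)
  moreover have "card (F \<union> N) = card F + card N" using finF finN FN by (rule card_Un_disjoint)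
  moreover have "card A = (\<Sum>v\<in>F. card (nbr G v)) + (\<Sum>v\<in>N. card (nbr G v \<inter> F))"
    unfolding A_def using finF finN FN by (subst card_Un_disjoint) auto
  moreover have "2 * card N \<le> (\<Sum>v\<in>N. card (nbr G v \<inter> F)) + card (single_contacts G F)"
  proof -
    have "2 * card N = (\<Sum>v\<in>N. 2)" by simp
    also have "\<dots> \<le> (\<Sum>v\<in>N. card (nbr G v \<inter> F) + (if v \<in> single_contacts G F then 1 else 0))"
    proof (rule sum_mono)
      fix v assume v: "v \<in> N"
      then have "nbr G v \<inter> F \<noteq> {}" using nbr_sym by (auto simp: N_def)
      then have "card (nbr G v \<inter> F) \<noteq> 0" using finF by simp
      moreover have "v \<in> single_contacts G F" if "card (nbr G v \<inter> F) = 1"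
        using that v nbr_subset by (auto simp: single_contacts_def N_def)
      ultimately show "2 \<le> card (nbr G v \<inter> F) + (if v \<in> single_contacts G F then 1 else 0)"
        by fastforce
    qed
    also have "\<dots> = (\<Sum>v\<in>N. card (nbr G v \<inter> F)) + card (N \<inter> single_contacts G F)"
      using finN by (simp add: sum.distrib flip: sum.inter_restrict)
    also have "\<dots> \<le> (\<Sum>v\<in>N. card (nbr G v \<inter> F)) + card (single_contacts G F)"
      by (simp add: card_mono)
    finally show ?thesis .
  qed
  ultimately show ?thesis by linarith
qed

text \<open>
  The forts of two vertices of degree 3 each. Non-adjacency characterises opposite vertices of a
  4-cycle, because a chord would create a triangle and thus a second cycle.
\<close>

definition obstructing_pair :: "'a pair_pre_digraph \<Rightarrow> ('a \<times> 'a) awalk \<Rightarrow> 'a \<Rightarrow> 'a \<Rightarrow> bool" where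
  "obstructing_pair G p u v \<longleftrightarrow> u \<in> cycle_verts p \<and> v \<in> cycle_verts p \<and> u \<noteq> v \<and>
     card (nbr G u) = 3 \<and> card (nbr G v) = 3 \<and>
     (length p = 3 \<or> length p = 4 \<and> (u, v) \<notin> parcs G)"

text \<open>
  Any triangle is the unique cycle, hence determines the girth; likewise for 4-cycles below.
\<close>

lemma length_cycle_eq_3:
  assumes "unicyclic G" "graph_cycle G p" "distinct [u, v, w]"
    "v \<in> nbr G u" "w \<in> nbr G v" "u \<in> nbr G w"
  shows "length p = 3" "cycle_verts p = {u, v, w}"
proof -
  have cp: "closed_path (parcs G) u [v, w]" using assms by (auto simp: closed_path_def nbr_def)
  have "pair_graph G" using assms by (simp add: unicyclic_def)
  from graph_cycle_zip[OF this cp] show "cycle_verts p = {u, v, w}"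
    using cycle_verts_unique[OF assms(1,2)] by simp
  with card_cycle_verts[OF assms(2)] show "length p = 3" using assms(3) by auto
qed

lemma length_cycle_eq_4:
  assumes "unicyclic G" "graph_cycle G p" "distinct [u, v, w, x]"
    "v \<in> nbr G u" "w \<in> nbr G v" "x \<in> nbr G w" "u \<in> nbr G x"
  shows "length p = 4" "cycle_verts p = {u, v, w, x}"
proof -
  have cp: "closed_path (parcs G) u [v, w, x]" using assms by (auto simp: closed_path_def nbr_def)
  have "pair_graph G" using assms by (simp add: unicyclic_def)
  from graph_cycle_zip[OF this cp] show "cycle_verts p = {u, v, w, x}"
    using cycle_verts_unique[OF assms(1,2)] by simp
  with card_cycle_verts[OF assms(2)] show "length p = 4" using assms(3) by auto
qed

text \<open>
  The degree sum bound is tight for two vertices, so both have degree 3. Removing the possible edge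
  between them and the set \<open>I\<close> of common neighbours from their neighbourhoods must leave at most two
  vertices in total, which leaves only the two configurations that close a triangle or a 4-cycle.
\<close>

lemma two_fort_is_obstructing_pair:
  assumes uni: "unicyclic G" and p: "graph_cycle G p" and F: "F \<subseteq> pverts G" "F \<noteq> {}"
    and deg: "\<And>v. v \<in> F \<Longrightarrow> 3 \<le> card (nbr G v)" and two: "card (single_contacts G F) \<le> 2"
  obtains u v where "F = {u, v}" "obstructing_pair G p u v"
proof -
  interpret pair_graph G using uni by (simp add: unicyclic_def)
  have finF: "finite F" using F pair_finite_verts finite_subset by blast
  have sum: "(\<Sum>v\<in>F. card (nbr G v)) \<le> 2 * card F + card (single_contacts G F)"
    using fort_degree_sum_le[OF uni F(1)] .
  moreover have "3 * card F \<le> (\<Sum>v\<in>F. card (nbr G v))"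
    using sum_mono[of F "\<lambda>_. 3" "\<lambda>v. card (nbr G v)"] deg by simp
  ultimately have "card F \<le> 2" using two by linarith
  moreover have "card F \<noteq> 0" using finF F by simp
  moreover have "card F \<noteq> 1"
  proof
    assume "card F = 1"
    then obtain v where "F = {v}" by (auto simp: card_1_singleton_iff)
    then show False using deg two by (force simp: single_contacts_singleton)
  qed
  ultimately have "card F = 2" by linarith
  then obtain u v where Fuv: "F = {u, v}" and uv: "u \<noteq> v" by (auto simp: card_2_iff)
  have "card (nbr G u) + card (nbr G v) \<le> 4 + card (single_contacts G F)"
    using sum uv by (simp add: Fuv)
  then have d: "card (nbr G u) = 3" "card (nbr G v) = 3"
    using deg[of u] deg[of v] two by (auto simp: Fuv)
  define I where "I = nbr G u \<inter> nbr G v"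
  have I: "finite I" "u \<notin> I" "v \<notin> I" by (simp_all add: I_def)
  have "single_contacts G F = (nbr G u - {v} - I) \<union> (nbr G v - {u} - I)"
    unfolding Fuv single_contacts_doubleton[OF uv] I_def by auto
  also have "card \<dots> = card (nbr G u - {v} - I) + card (nbr G v - {u} - I)"
    by (rule card_Un_disjoint) (auto simp: I_def)
  finally have contacts: "card (nbr G u - {v} - I) + card (nbr G v - {u} - I) \<le> 2"
    using two by simp
  have sub: "I \<subseteq> nbr G u - {v}" "I \<subseteq> nbr G v - {u}" using I by (auto simp: I_def)
  have cardI: "card (nbr G u - {v} - I) = card (nbr G u - {v}) - card I"
    "card (nbr G v - {u} - I) = card (nbr G v - {u}) - card I"
    using sub I by (simp_all add: card_Diff_subset)
  show thesis
  proof (cases "v \<in> nbr G u")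
    case True
    then have "card (nbr G u - {v}) = 2" "card (nbr G v - {u}) = 2"
      using d nbr_sym by auto
    with contacts cardI have "I \<noteq> {}" by auto
    then obtain w where w: "w \<in> nbr G u" "w \<in> nbr G v" by (auto simp: I_def)
    then have dist: "distinct [u, v, w]" using uv by auto
    from length_cycle_eq_3[OF uni p dist] True w nbr_sym
    have "length p = 3" "cycle_verts p = {u, v, w}" by auto
    then have "obstructing_pair G p u v" using uv d by (simp add: obstructing_pair_def)
    with Fuv show thesis by (rule that)
  next
    case False
    then have "nbr G u - {v} = nbr G u" "nbr G v - {u} = nbr G v" using nbr_sym by auto
    with contacts cardI d have "2 \<le> card I" by auto
    then obtain T where "T \<subseteq> I" "card T = 2" using obtain_subset_with_card_n by metis
    then obtain w x where wx: "w \<in> I" "x \<in> I" "w \<noteq> x" by (auto simp: card_2_iff)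
    then have dist: "distinct [u, w, v, x]" using uv I by auto
    from length_cycle_eq_4[OF uni p dist] wx nbr_sym
    have "length p = 4" "cycle_verts p = {u, w, v, x}" by (auto simp: I_def)
    then have "obstructing_pair G p u v" using uv d False by (simp add: obstructing_pair_def nbr_def)
    with Fuv show thesis by (rule that)
  qed
qed

lemma triangle_verts:
  assumes "pair_graph G" "graph_cycle G p" "length p = 3"
  obtains a b c where "cycle_verts p = {a, b, c}" "distinct [a, b, c]"
    "b \<in> nbr G a" "c \<in> nbr G b" "a \<in> nbr G c"
proof -
  obtain a b c where "p = [(a, b), (b, c), (c, a)]"
    using assms(2,3) by (auto simp: graph_cycle_iff numeral_3_eq_3 length_Suc_conv)
  with assms(2) cycle_verts_eq[OF assms(2)] show thesis
    by (intro that[of a b c]) (auto simp: graph_cycle_iff nbr_def)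
qed

lemma four_cycle_verts:
  assumes uni: "unicyclic G" and p: "graph_cycle G p" and len: "length p = 4"
  obtains a b c d where "cycle_verts p = {a, b, c, d}" "distinct [a, b, c, d]"
    "b \<in> nbr G a" "c \<in> nbr G b" "d \<in> nbr G c" "a \<in> nbr G d" "c \<notin> nbr G a" "d \<notin> nbr G b"
proof -
  interpret pair_graph G using uni by (simp add: unicyclic_def)
  obtain a b c d where "p = [(a, b), (b, c), (c, d), (d, a)]"
    using p len by (auto simp: graph_cycle_iff numeral_eq_Suc length_Suc_conv)
  with p cycle_verts_eq[OF p] have *: "cycle_verts p = {a, b, c, d}" "distinct [a, b, c, d]"
    "b \<in> nbr G a" "c \<in> nbr G b" "d \<in> nbr G c" "a \<in> nbr G d"
    by (auto simp: graph_cycle_iff nbr_def)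
  moreover have "c \<notin> nbr G a"
    using length_cycle_eq_3(1)[OF uni p, of a b c] * len nbr_sym by auto
  moreover have "d \<notin> nbr G b"
    using length_cycle_eq_3(1)[OF uni p, of b c d] * len nbr_sym by auto
  ultimately show thesis by (rule that)
qed

text \<open>
  Two of the three neighbours of each vertex are not single contacts: in a triangle the other
  vertex of the pair and the third cycle vertex, in a 4-cycle the other two cycle vertices. At most
  one single contact remains for each.
\<close>

lemma obstructing_pair_is_two_fort:
  assumes uni: "unicyclic G" and p: "graph_cycle G p" and ob: "obstructing_pair G p u v"
  shows "card (single_contacts G {u, v}) \<le> 2"
proof -
  interpret pair_graph G using uni by (simp add: unicyclic_def)
  have uv: "u \<noteq> v" "card (nbr G u) = 3" "card (nbr G v) = 3"
    using ob by (auto simp: obstructing_pair_def)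
  have rest: "card (nbr G x - {y, z}) = 1"
    if "card (nbr G x) = 3" "y \<in> nbr G x" "z \<in> nbr G x" "y \<noteq> z" for x y z
    using that by (simp add: card_Diff_subset)
  have bound: "card (single_contacts G {u, v}) \<le> 2"
    if "single_contacts G {u, v} \<subseteq> (nbr G u - {y, z}) \<union> (nbr G v - {y', z'})"
      "y \<in> nbr G u" "z \<in> nbr G u" "y \<noteq> z" "y' \<in> nbr G v" "z' \<in> nbr G v" "y' \<noteq> z'" for y z y' z'
  proof -
    have "card (single_contacts G {u, v}) \<le> card ((nbr G u - {y, z}) \<union> (nbr G v - {y', z'}))"
      using that(1) by (rule card_mono[rotated]) simp
    also have "\<dots> \<le> card (nbr G u - {y, z}) + card (nbr G v - {y', z'})" by (rule card_Un_le)
    also have "\<dots> = 2" using that uv rest by simp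
    finally show ?thesis .
  qed
  consider "length p = 3" | "length p = 4" "v \<notin> nbr G u"
    using ob by (auto simp: obstructing_pair_def nbr_def)
  then show ?thesis
  proof cases
    case 1
    from triangle_verts[OF pair_graph p 1] obtain a b c where abc: "cycle_verts p = {a, b, c}"
      "distinct [a, b, c]" "b \<in> nbr G a" "c \<in> nbr G b" "a \<in> nbr G c" .
    then obtain w where "v \<in> nbr G u" "w \<in> nbr G u" "w \<in> nbr G v" "w \<noteq> u" "w \<noteq> v"
      using ob nbr_sym unfolding obstructing_pair_def by auto
    then show ?thesis
      using uv nbr_sym by (intro bound[of v w u w]) (auto simp: single_contacts_doubleton)
  next
    case 2
    from four_cycle_verts[OF uni p 2(1)] obtain a b c d where abcd: "cycle_verts p = {a, b, c, d}"
      "distinct [a, b, c, d]" "b \<in> nbr G a" "c \<in> nbr G b" "d \<in> nbr G c" "a \<in> nbr G d"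
      "c \<notin> nbr G a" "d \<notin> nbr G b" .
    then obtain w x where "w \<noteq> x" "w \<in> nbr G u" "w \<in> nbr G v" "x \<in> nbr G u" "x \<in> nbr G v"
      using ob 2 nbr_sym unfolding obstructing_pair_def by auto
    then show ?thesis
      using uv by (intro bound[of w x w x]) (auto simp: single_contacts_doubleton)
  qed
qed

lemma two_leaky_forcing_set_iff:
  assumes uni: "unicyclic G" and p: "graph_cycle G p"
  shows "leaky_forcing_set 2 G S \<longleftrightarrow> S \<subseteq> pverts G \<and> {v \<in> pverts G. card (nbr G v) \<le> 2} \<subseteq> S \<and>
    (\<forall>u v. obstructing_pair G p u v \<longrightarrow> u \<in> S \<or> v \<in> S)"
proof -
  interpret pair_graph G using uni by (simp add: unicyclic_def)
  have C: "cycle_verts p \<subseteq> pverts G"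
    using p by (auto simp: cycle_verts_eq graph_cycle_iff dest: arc_snd_in_verts)
  have "card (cycle_verts p) \<le> card (pverts G)" using C pair_finite_verts by (rule card_mono[rotated])
  then have "2 \<le> card (pverts G)" using card_cycle_verts[OF p] p by (auto simp: graph_cycle_iff)
  note iff = leaky_forcing_set_iff_fort[OF this]
  show ?thesis
  proof (intro iffI conjI)
    assume S: "leaky_forcing_set 2 G S"
    show "S \<subseteq> pverts G" using S by (simp add: leaky_forcing_set_def)
    show "{v \<in> pverts G. card (nbr G v) \<le> 2} \<subseteq> S"
    proof
      fix v assume "v \<in> {v \<in> pverts G. card (nbr G v) \<le> 2}"
      then have "{v} \<inter> S \<noteq> {}"
        using S[unfolded iff] by (metis (no_types, lifting) empty_not_insert empty_subsetI
            insert_subset mem_Collect_eq single_contacts_singleton)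
      then show "v \<in> S" by simp
    qed
    show "\<forall>u v. obstructing_pair G p u v \<longrightarrow> u \<in> S \<or> v \<in> S"
    proof (intro allI impI)
      fix u v assume ob: "obstructing_pair G p u v"
      then have "{u, v} \<subseteq> pverts G" using C by (auto simp: obstructing_pair_def)
      then have "{u, v} \<inter> S \<noteq> {}"
        using S[unfolded iff] obstructing_pair_is_two_fort[OF uni p ob] by blast
      then show "u \<in> S \<or> v \<in> S" by blast
    qed
  next
    assume S: "S \<subseteq> pverts G \<and> {v \<in> pverts G. card (nbr G v) \<le> 2} \<subseteq> S \<and>
      (\<forall>u v. obstructing_pair G p u v \<longrightarrow> u \<in> S \<or> v \<in> S)"
    show "leaky_forcing_set 2 G S"
      unfolding iff
    proof (intro conjI allI impI notI)
      fix F assume F: "F \<subseteq> pverts G" "F \<noteq> {} \<and> card (single_contacts G F) \<le> 2" "F \<inter> S = {}"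
      then have "3 \<le> card (nbr G v)" if "v \<in> F" for v using S that by force
      with F obtain u v where "F = {u, v}" "obstructing_pair G p u v"
        using two_fort_is_obstructing_pair[OF uni p, of F] by blast
      then show False using S F by blast
    qed (use S in simp)
  qed
qed

section \<open>The 2-leaky forcing number\<close>

text \<open>
  Every forcing set contains \<open>R\<close>, from which sets of vertices of degree 3 are disjoint. So \<open>R \<union> T\<close> is
  smallest as soon as every other cover has as many vertices of degree 3 as \<open>T\<close>.
\<close>

lemma two_leaky_forcing_number_eqI:
  assumes uni: "unicyclic G" and p: "graph_cycle G p"
  defines "R \<equiv> {v \<in> pverts G. card (nbr G v) \<le> 2}"
  assumes T: "T \<subseteq> cycle_verts p" "\<And>v. v \<in> T \<Longrightarrow> card (nbr G v) = 3"
    and cover: "\<And>u v. obstructing_pair G p u v \<Longrightarrow> u \<in> T \<or> v \<in> T"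
    and minimal: "\<And>S. (\<And>u v. obstructing_pair G p u v \<Longrightarrow> u \<in> S \<or> v \<in> S) \<Longrightarrow>
      \<exists>T'. T' \<subseteq> S \<and> card T' = card T \<and> (\<forall>v\<in>T'. card (nbr G v) = 3)"
  shows "leaky_forcing_number 2 G = card R + card T"
  unfolding leaky_forcing_number_def
proof (rule Least_equality)
  interpret pair_graph G using uni by (simp add: unicyclic_def)
  have finR: "finite R" by (simp add: R_def pair_finite_verts)
  have C: "cycle_verts p \<subseteq> pverts G"
    using p by (auto simp: cycle_verts_eq graph_cycle_iff dest: arc_snd_in_verts)
  show "\<exists>S. leaky_forcing_set 2 G S \<and> card S = card R + card T"
  proof (intro exI conjI)
    show "leaky_forcing_set 2 G (R \<union> T)"
      unfolding two_leaky_forcing_set_iff[OF uni p] using C T(1) cover by (auto simp: R_def)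
    have "finite T" using T C pair_finite_verts finite_subset by metis
    then show "card (R \<union> T) = card R + card T"
      using finR T(2) by (intro card_Un_disjoint) (auto simp: R_def)
  qed
  fix k assume "\<exists>S. leaky_forcing_set 2 G S \<and> card S = k"
  then obtain S where S: "leaky_forcing_set 2 G S" "card S = k" by blast
  note S' = S(1)[unfolded two_leaky_forcing_set_iff[OF uni p], folded R_def]
  from minimal[of S] S' obtain T' where T': "T' \<subseteq> S" "card T' = card T"
    "\<forall>v\<in>T'. card (nbr G v) = 3" by auto
  have finS: "finite S" using S' pair_finite_verts finite_subset by metis
  then have "card R + card T = card (R \<union> T')"
    using T' finR finite_subset[OF T'(1)] by (subst card_Un_disjoint) (auto simp: R_def)
  also have "\<dots> \<le> card S" using T'(1) S' finS by (intro card_mono) auto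
  finally show "card R + card T \<le> k" using S by simp
qed

theorem theorem3p8:
  fixes G :: "'a pair_pre_digraph" and p :: "('a \<times> 'a) awalk"
  assumes "unicyclic G" and "graph_cycle G p"
  shows "let g = length p;
             C = cycle_verts p;
             deg = out_degree (with_proj G);
             R = {v \<in> pverts G. deg v \<le> 2};
             r = card R
         in leaky_forcing_number 2 G =
           (if g \<in> {3, 4} \<and> (\<forall>v\<in>C. deg v = 3) then r + 2
            else if (g = 3 \<and> card {v \<in> C. deg v = 3} \<ge> 2) \<or>
                    (g = 4 \<and> ((\<exists>u\<in>C. \<exists>v\<in>C. u \<noteq> v \<and> (u, v) \<notin> parcs G \<and> deg u = 3 \<and> deg v = 3) \<or>
                              card {v \<in> C. deg v = 3} \<ge> 3)) then r + 1
            else r)"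
proof -
  interpret pair_graph G using assms by (simp add: unicyclic_def)
  note number_eqI = two_leaky_forcing_number_eqI[OF assms]
  define g where "g = length p"
  define C where "C = cycle_verts p"
  define deg where "deg v = card (nbr G v)" for v
  define r where "r = card {v \<in> pverts G. deg v \<le> 2}"
  define D where "D = {v \<in> C. deg v = 3}"
  define ob where "ob u v \<longleftrightarrow> obstructing_pair G p u v" for u v
  have ob_iff: "ob u v \<longleftrightarrow> u \<in> D \<and> v \<in> D \<and> u \<noteq> v \<and> (g = 3 \<or> g = 4 \<and> v \<notin> nbr G u)" for u v
    by (auto simp: ob_def obstructing_pair_def D_def C_def deg_def g_def nbr_def)
  have finC: "finite C" by (simp add: C_def cycle_verts_eq[OF assms(2)])
  have number: "leaky_forcing_number 2 G = r + card T"
    if "T \<subseteq> D" "\<And>u v. ob u v \<Longrightarrow> u \<in> T \<or> v \<in> T"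
      "\<And>S. (\<And>u v. ob u v \<Longrightarrow> u \<in> S \<or> v \<in> S) \<Longrightarrow> \<exists>T' \<subseteq> S \<inter> D. card T' = card T"
    for T
    unfolding r_def deg_def
  proof (rule number_eqI)
    show "T \<subseteq> cycle_verts p" using that(1) by (auto simp: D_def C_def)
    show "\<And>v. v \<in> T \<Longrightarrow> card (nbr G v) = 3" using that(1) by (auto simp: D_def deg_def)
    show "\<And>u v. obstructing_pair G p u v \<Longrightarrow> u \<in> T \<or> v \<in> T" using that(2) by (simp add: ob_def)
    fix S assume "\<And>u v. obstructing_pair G p u v \<Longrightarrow> u \<in> S \<or> v \<in> S"
    then have "\<exists>T' \<subseteq> S \<inter> D. card T' = card T" by (intro that(3)) (simp add: ob_def)
    then show "\<exists>T'. T' \<subseteq> S \<and> card T' = card T \<and> (\<forall>v\<in>T'. card (nbr G v) = 3)"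
      by (auto simp: D_def deg_def)
  qed
  have triangle: "\<exists>a b c. C = {a, b, c} \<and> distinct [a, b, c]" if "g = 3"
    using triangle_verts[OF pair_graph assms(2)] that unfolding g_def C_def by metis
  \<comment> \<open>On a 4-cycle the obstructing pairs are the diagonals with both ends of degree 3.\<close>
  have four_cycle: "\<exists>a b c d. C = {a, b, c, d} \<and> distinct [a, b, c, d] \<and>
      (\<forall>u v. ob u v \<longleftrightarrow> u \<in> D \<and> v \<in> D \<and> ({u, v} = {a, c} \<or> {u, v} = {b, d}))" if "g = 4"
  proof -
    from four_cycle_verts[OF assms] that obtain a b c d where *: "C = {a, b, c, d}"
      "distinct [a, b, c, d]" "b \<in> nbr G a" "c \<in> nbr G b" "d \<in> nbr G c" "a \<in> nbr G d"
      "c \<notin> nbr G a" "d \<notin> nbr G b" unfolding g_def C_def by metis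
    have "ob u v \<longleftrightarrow> u \<in> D \<and> v \<in> D \<and> ({u, v} = {a, c} \<or> {u, v} = {b, d})" for u v
    proof (cases "u \<in> C \<and> v \<in> C")
      case True
      then show ?thesis using * that nbr_sym unfolding ob_iff doubleton_eq_iff by auto
    qed (auto simp: ob_iff D_def)
    then show ?thesis using * by blast
  qed
  have card2: "\<exists>T' \<subseteq> S. card T' = 2" if "x \<in> S" "y \<in> S" "x \<noteq> y" for x y :: 'a and S
    using that by (intro exI[of _ "{x, y}"]) auto
  have "leaky_forcing_number 2 G =
     (if g \<in> {3, 4} \<and> (\<forall>v\<in>C. deg v = 3) then r + 2
      else if (g = 3 \<and> card D \<ge> 2) \<or>
              (g = 4 \<and> ((\<exists>u\<in>C. \<exists>v\<in>C. u \<noteq> v \<and> (u, v) \<notin> parcs G \<and> deg u = 3 \<and> deg v = 3) \<or>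
                        card D \<ge> 3)) then r + 1
      else r)" (is "_ = (if ?full then _ else if ?part then _ else _)")
  proof -
    consider "?full" "g = 3" | "?full" "g = 4" | "\<not> ?full" "?part" | "\<not> ?full" "\<not> ?part" by blast
    then show ?thesis
    proof cases
      case 1
      then have CD: "D = C" by (auto simp: D_def)
      obtain a b c where abc: "C = {a, b, c}" "distinct [a, b, c]" using triangle 1 by blast
      have "leaky_forcing_number 2 G = r + card {a, b}"
      proof (rule number)
        fix S assume S: "\<And>u v. ob u v \<Longrightarrow> u \<in> S \<or> v \<in> S"
        have D: "a \<in> D" "b \<in> D" "c \<in> D" using CD abc by simp_all
        then have "ob a b" "ob b c" "ob a c" using abc(2) 1(2) by (simp_all add: ob_iff)
        then have "a \<in> S \<or> b \<in> S" "b \<in> S \<or> c \<in> S" "a \<in> S \<or> c \<in> S" using S by blast+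
        then obtain x y where "x \<in> S \<inter> D" "y \<in> S \<inter> D" "x \<noteq> y" using D abc(2) by auto
        from card2[OF this] show "\<exists>T' \<subseteq> S \<inter> D. card T' = card {a, b}" using abc(2) by (simp add: numeral_2_eq_2)
      qed (use abc CD in \<open>auto simp: ob_iff\<close>)
      then show ?thesis using 1 abc by simp
    next
      case 2
      then have CD: "D = C" by (auto simp: D_def)
      obtain a b c d where abcd: "C = {a, b, c, d}" "distinct [a, b, c, d]"
        and ob: "\<And>u v. ob u v \<longleftrightarrow> u \<in> D \<and> v \<in> D \<and> ({u, v} = {a, c} \<or> {u, v} = {b, d})"
        using four_cycle 2 by blast
      have "leaky_forcing_number 2 G = r + card {a, b}"
      proof (rule number)
        fix S assume S: "\<And>u v. ob u v \<Longrightarrow> u \<in> S \<or> v \<in> S"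
        have D: "a \<in> D" "b \<in> D" "c \<in> D" "d \<in> D" using CD abcd by simp_all
        then have "ob a c" "ob b d" by (simp_all add: ob)
        then have "a \<in> S \<or> c \<in> S" "b \<in> S \<or> d \<in> S" using S by blast+
        then obtain x y where "x \<in> S \<inter> D" "y \<in> S \<inter> D" "x \<noteq> y" using D abcd(2) by auto
        from card2[OF this] show "\<exists>T' \<subseteq> S \<inter> D. card T' = card {a, b}" using abcd(2) by (simp add: numeral_2_eq_2)
      qed (use abcd CD in \<open>auto simp: ob doubleton_eq_iff\<close>)
      then show ?thesis using 2 abcd by simp
    next
      case 3
      \<comment> \<open>Some vertex \<open>u\<close> of an obstructing pair meets all of them, since some cycle vertex is not of degree 3.\<close>
      have "\<exists>u v. ob u v \<and> (\<forall>x y. ob x y \<longrightarrow> u = x \<or> u = y)"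
      proof (cases "g = 3")
        case True
        then obtain a b c where abc: "C = {a, b, c}" "distinct [a, b, c]" using triangle by blast
        have "2 \<le> card D" using 3 True by simp
        then obtain T where "T \<subseteq> D" "card T = 2" using obtain_subset_with_card_n by metis
        then obtain u v where uv: "u \<in> D" "v \<in> D" "u \<noteq> v" by (auto simp: card_2_iff)
        have "x = u \<or> x = v" if "x \<in> D" for x
          using that uv 3(1) True abc by (auto simp: D_def)
        then show ?thesis using uv True unfolding ob_iff by blast
      next
        case False
        with 3 have "g = 4" by simp
        then obtain a b c d where abcd: "C = {a, b, c, d}" "distinct [a, b, c, d]"
          and ob: "\<And>u v. ob u v \<longleftrightarrow> u \<in> D \<and> v \<in> D \<and> ({u, v} = {a, c} \<or> {u, v} = {b, d})"
          using four_cycle by blast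
        have D: "D \<subseteq> {a, b, c, d}" using abcd by (auto simp: D_def)
        have notall: "\<not> {a, b, c, d} \<subseteq> D" using 3(1) \<open>g = 4\<close> abcd by (auto simp: D_def)
        have "{a, c} \<subseteq> D \<or> {b, d} \<subseteq> D"
        proof (cases "3 \<le> card D")
          case True
          show ?thesis
          proof (rule ccontr)
            \<comment> \<open>Otherwise each diagonal contributes at most one vertex to \<open>D\<close>.\<close>
            assume "\<not> ?thesis"
            then obtain x y where "D \<subseteq> {x, y}" using D by auto
            then have "card D \<le> card {x, y}" by (intro card_mono) auto
            also have "\<dots> \<le> 2" using card_length[of "[x, y]"] by simp
            finally show False using True by simp
          qed
        next
          case False
          then obtain u v where "ob u v"
            using 3(2) \<open>g = 4\<close> unfolding ob_iff by (auto simp: D_def nbr_def)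
          then show ?thesis by (auto simp: ob)
        qed
        then show ?thesis
        proof
          \<comment> \<open>The other diagonal has an end of another degree, so this one is the only obstructing pair.\<close>
          assume *: "{a, c} \<subseteq> D"
          then have "\<not> {b, d} \<subseteq> D" using notall by auto
          then show ?thesis using *
            by (intro exI[of _ a] exI[of _ c]) (auto simp: ob doubleton_eq_iff)
        next
          assume *: "{b, d} \<subseteq> D"
          then have "\<not> {a, c} \<subseteq> D" using notall by auto
          then show ?thesis using *
            by (intro exI[of _ b] exI[of _ d]) (auto simp: ob doubleton_eq_iff)
        qed
      qed
      then obtain u v where uv: "ob u v" "\<And>x y. ob x y \<Longrightarrow> u = x \<or> u = y" by blast
      have "leaky_forcing_number 2 G = r + card {u}"
      proof (rule number)
        fix S assume "\<And>u v. ob u v \<Longrightarrow> u \<in> S \<or> v \<in> S"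
        then obtain x where "x \<in> S \<inter> D" using uv(1) unfolding ob_iff by blast
        then show "\<exists>T' \<subseteq> S \<inter> D. card T' = card {u}" by (intro exI[of _ "{x}"]) auto
      qed (use uv in \<open>auto simp: ob_iff\<close>)
      then show ?thesis using 3 by simp
    next
      case 4
      have no_ob: "\<not> ob u v" for u v
      proof
        assume o: "ob u v"
        then have "{u, v} \<subseteq> D" "card {u, v} = 2" by (auto simp: ob_iff)
        moreover have "finite D" using finC by (simp add: D_def)
        ultimately have "2 \<le> card D" by (metis card_mono)
        with o 4(2) show False unfolding ob_iff by (auto simp: D_def nbr_def)
      qed
      have "leaky_forcing_number 2 G = r + card ({} :: 'a set)"
        by (rule number) (use no_ob in auto)
      then show ?thesis using 4 by simp
    qed
  qed
  then show ?thesis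
    unfolding Let_def out_degree_eq_card_nbr g_def C_def r_def D_def deg_def .
qed

end
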